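(* Let $R$ be either the free associative algebra $\mathcal{A}_r$ or the free group algebra $\mathcal{F}_r$ of rank $r>1$ over a field $\Phi$. Then in every right $R$-module $M$ there is a largest submodule $N=\mathcal{N}(M)$ whose growth is not maximal. At the same time, the growth of every nonzero submodule of $M/N$ is maximal.
   Context: $X$ is a finite set with $r>1$ elements; $\mathcal{A}_r=\Phi\langle X\rangle$ is the free associative algebra with $1$ on $X$, and $\mathcal{F}_r=\Phi F_r$ is the group algebra of the free group $F_r$ with free basis $X$. Put $R(n)$ equal to the linear span of all words in $X$ of length at most $n$ (for $R=\mathcal{A}_r$), respectively of all elements of $F_r$ of reduced length at most $n$ in $X\cup X^{-1}$ (for $R=\mathcal{F}_r$). For a right $R$-module $V$ generated by a finite set $A$ the growth function is $g_{A,V}(n)=\dim_\Phi(A R(n))$. Functions $f,g$ are equivalent if for some nonnegative integers $C,C'$ one has $f(n)\le g(n+C)$ and $g(n)\le f(n+C')$ for all $n\ge0$; the equivalence class of $g_{A,V}$ is independent of $A$ and is called the growth of $V$. A finitely generated module has maximal growth if its growth equals that of the free module of rank 1, i.e. its growth function is equivalent to $r^n$ (for $\mathcal{A}_r$) or $(2r-1)^n$ (for $\mathcal{F}_r$). An arbitrary (not necessarily finitely generated) module is said to be of maximal growth (its growth is maximal) if it contains a finitely generated submodule of maximal growth; otherwise its growth is not maximal. *)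

theory Defs
  imports
    "HOL-Library.Poly_Mapping"
    "HOL-Algebra.QuotRing"
    "Jordan_Normal_Form.VS_Connect"
begin

section \<open>Free monoids, free groups and their algebras\<close>

text \<open>
  The monoid algebra of a monoid \<open>'g\<close> over \<open>'k\<close> is \<open>'g \<Rightarrow>\<^sub>0 'k\<close>: finitely supported functions, with
  the convolution product of \<^theory>\<open>HOL-Library.Poly_Mapping\<close>. That product is based on the class
  \<^class>\<open>monoid_add\<close>, so the monoids below are written additively although they are not commutative.
\<close>

class word_monoid = monoid_add +
  fixes word_length :: "'a \<Rightarrow> nat"

typedef 'x free_monoid = "UNIV :: 'x list set"
  by simp

setup_lifting type_definition_free_monoid

instantiation free_monoid :: (type) word_monoid
begin

lift_definition zero_free_monoid :: "'a free_monoid" is "[]" .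
lift_definition plus_free_monoid :: "'a free_monoid \<Rightarrow> 'a free_monoid \<Rightarrow> 'a free_monoid" is "(@)" .
lift_definition word_length_free_monoid :: "'a free_monoid \<Rightarrow> nat" is length .

instance
  by standard (transfer; simp)+

end

text \<open>
  Elements of the free group are the reduced words. A letter is a pair of a generator \<open>x\<close> and a sign:
  \<open>(x, True)\<close> is \<open>x\<close> and \<open>(x, False)\<close> is the inverse of \<open>x\<close>.
\<close>

definition inv_letter :: "'x \<times> bool \<Rightarrow> 'x \<times> bool" where
  "inv_letter a = (fst a, \<not> snd a)"

definition reduced :: "('x \<times> bool) list \<Rightarrow> bool" where
  "reduced = successively (\<lambda>a b. b \<noteq> inv_letter a)"

definition reduced_Cons :: "'x \<times> bool \<Rightarrow> ('x \<times> bool) list \<Rightarrow> ('x \<times> bool) list" where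
  "reduced_Cons a w = (if w \<noteq> [] \<and> hd w = inv_letter a then tl w else a # w)"

lemma inv_letter_inv_letter [simp]: "inv_letter (inv_letter a) = a"
  by (simp add: inv_letter_def)

lemma inv_letter_neq [simp]: "inv_letter a \<noteq> a" "a \<noteq> inv_letter a"
  by (cases a; simp add: inv_letter_def)+

lemma reduced_Nil [simp]: "reduced []"
  by (simp add: reduced_def)

lemma reduced_Cons_iff: "reduced (a # w) \<longleftrightarrow> (w = [] \<or> hd w \<noteq> inv_letter a) \<and> reduced w"
  by (cases w) (auto simp: reduced_def)

lemma reduced_reduced_Cons: "reduced w \<Longrightarrow> reduced (reduced_Cons a w)"
  by (cases w) (auto simp: reduced_Cons_def reduced_Cons_iff)

lemma reduced_foldr: "reduced w \<Longrightarrow> reduced (foldr reduced_Cons u w)"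
  by (induction u) (auto simp: reduced_reduced_Cons)

lemma reduced_Cons_cancel:
  "reduced w \<Longrightarrow> reduced_Cons a (reduced_Cons (inv_letter a) w) = w"
  by (cases w; cases "tl w") (auto simp: reduced_Cons_def reduced_Cons_iff)

lemma foldr_reduced_Cons_Nil: "reduced w \<Longrightarrow> foldr reduced_Cons w [] = w"
  by (induction w) (auto simp: reduced_Cons_iff reduced_Cons_def)

lemma foldr_reduced_Cons:
  assumes "reduced w"
  shows "foldr reduced_Cons (reduced_Cons a t) w = reduced_Cons a (foldr reduced_Cons t w)"
proof (cases t)
  case (Cons b v)
  then show ?thesis
    using reduced_Cons_cancel[OF reduced_foldr[OF assms], of a v]
    by (auto simp: reduced_Cons_def[of a "b # v"])
qed (simp add: reduced_Cons_def)

lemma foldr_reduced_Cons_assoc: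
  assumes "reduced w"
  shows "foldr reduced_Cons (foldr reduced_Cons u v) w = foldr reduced_Cons u (foldr reduced_Cons v w)"
  by (induction u) (simp_all add: foldr_reduced_Cons assms)

lemma reduced_inverse: "reduced w \<Longrightarrow> reduced (rev (map inv_letter w))"
  unfolding reduced_def
  by (auto simp: successively_rev successively_map intro: successively_mono)

lemma foldr_reduced_Cons_inverse: "foldr reduced_Cons (rev (map inv_letter u)) u = []"
  by (induction u) (auto simp: reduced_Cons_def)

typedef 'x free_group = "{w :: ('x \<times> bool) list. reduced w}"
  by (rule exI[of _ "[]"]) simp

setup_lifting type_definition_free_group

instantiation free_group :: (type) "{group_add, word_monoid}"
begin

lift_definition zero_free_group :: "'a free_group" is "[]"
  by simp
lift_definition plus_free_group :: "'a free_group \<Rightarrow> 'a free_group \<Rightarrow> 'a free_group"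
  is "foldr reduced_Cons"
  by (rule reduced_foldr)
lift_definition uminus_free_group :: "'a free_group \<Rightarrow> 'a free_group"
  is "\<lambda>w. rev (map inv_letter w)"
  by (rule reduced_inverse)
definition minus_free_group :: "'a free_group \<Rightarrow> 'a free_group \<Rightarrow> 'a free_group" where
  "minus_free_group u v = u + - v"
lift_definition word_length_free_group :: "'a free_group \<Rightarrow> nat" is length .

instance
proof
  fix u v w :: "'a free_group"
  show "u + v + w = u + (v + w)"
    by transfer (rule foldr_reduced_Cons_assoc)
  show "0 + u = u"
    by transfer simp
  show "u + 0 = u"
    by transfer (rule foldr_reduced_Cons_Nil)
  show "- u + u = 0"
    by transfer (rule foldr_reduced_Cons_inverse)
  show "u + - v = u - v"
    by (simp add: minus_free_group_def)
qed

end

type_synonym ('x, 'k) free_algebra = "'x free_monoid \<Rightarrow>\<^sub>0 'k"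
type_synonym ('x, 'k) free_group_algebra = "'x free_group \<Rightarrow>\<^sub>0 'k"


section \<open>Right modules\<close>

text \<open>
  HOL-Algebra only has left modules over commutative rings. As in its record for those, the fields
  for multiplication and one are present only because \<^locale>\<open>abelian_group\<close> is stated for rings; they
  carry no meaning.
\<close>

record ('m, 'r) right_module = "'m ring" +
  act :: "'m \<Rightarrow> 'r \<Rightarrow> 'm" (infixl \<open>\<triangleleft>\<index>\<close> 70)

locale right_module = abelian_group M
  for M :: "('m, 'r :: ring_1, 'z) right_module_scheme" (structure) +
  assumes act_closed [simp, intro]: "x \<in> carrier M \<Longrightarrow> x \<triangleleft> a \<in> carrier M"
    and act_add_left: "x \<in> carrier M \<Longrightarrow> y \<in> carrier M \<Longrightarrow> (x \<oplus> y) \<triangleleft> a = x \<triangleleft> a \<oplus> y \<triangleleft> a"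
    and act_add_right: "x \<in> carrier M \<Longrightarrow> x \<triangleleft> (a + b) = x \<triangleleft> a \<oplus> x \<triangleleft> b"
    and act_mult: "x \<in> carrier M \<Longrightarrow> x \<triangleleft> (a * b) = (x \<triangleleft> a) \<triangleleft> b"
    and act_one [simp]: "x \<in> carrier M \<Longrightarrow> x \<triangleleft> 1 = x"

definition right_submodule :: "('m, 'r, 'z) right_module_scheme \<Rightarrow> 'm set \<Rightarrow> bool" where
  "right_submodule M N \<longleftrightarrow> additive_subgroup N M \<and> (\<forall>x\<in>N. \<forall>a. x \<triangleleft>\<^bsub>M\<^esub> a \<in> N)"

definition generated_by :: "('m, 'r, 'z) right_module_scheme \<Rightarrow> 'm set \<Rightarrow> bool" where
  "generated_by M A \<longleftrightarrow> A \<subseteq> carrier M \<and> \<Inter>{N. right_submodule M N \<and> A \<subseteq> N} = carrier M"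

definition quotient_module ::
    "('m, 'r, 'z) right_module_scheme \<Rightarrow> 'm set \<Rightarrow> ('m set, 'r) right_module" where
  "quotient_module M N =
    \<lparr>carrier = a_rcosets\<^bsub>M\<^esub> N, mult = (\<lambda>_ _. N), one = N, zero = N, add = set_add M,
     act = (\<lambda>X a. \<Union>x\<in>X. N +>\<^bsub>M\<^esub> (x \<triangleleft>\<^bsub>M\<^esub> a))\<rparr>"

definition regular_module :: "('r :: ring_1, 'r) right_module" where
  "regular_module = \<lparr>carrier = UNIV, mult = (*), one = 1, zero = 0, add = (+), act = (*)\<rparr>"

lemma abelian_group_regular_module: "abelian_group regular_module"
proof (rule abelian_groupI)
  fix x :: 'a assume "x \<in> carrier regular_module"
  show "\<exists>y\<in>carrier regular_module. y \<oplus>\<^bsub>regular_module\<^esub> x = \<zero>\<^bsub>regular_module\<^esub>"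
    by (rule bexI[of _ "- x"]) (auto simp: regular_module_def)
qed (auto simp: regular_module_def algebra_simps)

lemma right_module_regular_module: "right_module regular_module"
  by (intro right_module.intro abelian_group_regular_module right_module_axioms.intro)
     (auto simp: regular_module_def algebra_simps)

context right_module
begin

lemma abelian_subgroup_right_submodule: "right_submodule M N \<Longrightarrow> abelian_subgroup N M"
  by (intro abelian_subgroupI3 abelian_group_axioms) (simp add: right_submodule_def)

lemma right_module_submodule:
  assumes "right_submodule M N"
  shows "right_module (M\<lparr>carrier := N\<rparr>)"
proof -
  interpret N: abelian_subgroup N M
    by (rule abelian_subgroup_right_submodule[OF assms])
  have "abelian_group (M\<lparr>carrier := N\<rparr>)"
  proof (rule abelian_groupI)
    fix x assume "x \<in> carrier (M\<lparr>carrier := N\<rparr>)"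
    then show "\<exists>y\<in>carrier (M\<lparr>carrier := N\<rparr>). y \<oplus>\<^bsub>M\<lparr>carrier := N\<rparr>\<^esub> x = \<zero>\<^bsub>M\<lparr>carrier := N\<rparr>\<^esub>"
      by (intro bexI[of _ "\<ominus> x"]) (auto simp: l_neg)
  qed (auto simp: a_ac)
  moreover have "N \<subseteq> carrier M"
    by (rule N.a_subset)
  ultimately show ?thesis
    using assms
    by (intro right_module.intro right_module_axioms.intro)
       (auto simp: right_submodule_def subset_iff act_add_left act_add_right act_mult)
qed

lemma act_quotient_module:
  assumes "right_submodule M N" "x \<in> carrier M"
  shows "(N +> x) \<triangleleft>\<^bsub>quotient_module M N\<^esub> a = N +> x \<triangleleft> a"
proof -
  interpret N: abelian_subgroup N M
    by (rule abelian_subgroup_right_submodule[OF assms(1)])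
  have "N +> y \<triangleleft> a = N +> x \<triangleleft> a" if "y \<in> N +> x" for y
  proof -
    from that obtain n where n: "n \<in> N" "y = n \<oplus> x"
      by (auto simp: a_r_coset_def')
    then have "y \<triangleleft> a = n \<triangleleft> a \<oplus> x \<triangleleft> a" "n \<triangleleft> a \<in> N"
      using assms by (auto simp: right_submodule_def act_add_left)
    then have "y \<triangleleft> a \<in> N +> x \<triangleleft> a"
      by (auto simp: a_r_coset_def')
    then show ?thesis
      by (rule a_repr_independence[symmetric]) (use assms(2) N.a_subgroup in auto)
  qed
  then have "(\<Union>y\<in>N +> x. N +> y \<triangleleft> a) = N +> x \<triangleleft> a"
    using N.a_rcos_self[OF assms(2)] by blast
  then show ?thesis
    by (simp add: quotient_module_def)
qed

lemma right_module_quotient_module: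
  assumes "right_submodule M N"
  shows "right_module (quotient_module M N)"
proof -
  interpret N: abelian_subgroup N M
    by (rule abelian_subgroup_right_submodule[OF assms])
  interpret Q: comm_group "M A_Mod N"
    by (rule N.a_factorgroup_is_comm_group)
  have eq: "carrier (quotient_module M N) = carrier (M A_Mod N)"
    "add (quotient_module M N) = mult (M A_Mod N)" "zero (quotient_module M N) = one (M A_Mod N)"
    by (simp_all add: quotient_module_def A_FactGroup_def')
  have "abelian_group (quotient_module M N)"
    by (rule abelian_groupI; unfold eq)
       (fact Q.m_closed Q.one_closed Q.m_assoc Q.m_comm Q.l_one Q.l_inv_ex)+
  moreover have "carrier (quotient_module M N) = (+>) N ` carrier M"
    by (auto simp: quotient_module_def A_RCOSETS_def' a_r_coset_def')
  moreover have "(N +> x) \<oplus>\<^bsub>quotient_module M N\<^esub> (N +> y) = N +> (x \<oplus> y)"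
    if "x \<in> carrier M" "y \<in> carrier M" for x y
    using N.a_rcos_sum[OF that] by (simp add: quotient_module_def)
  ultimately show ?thesis
    by (intro right_module.intro right_module_axioms.intro)
       (auto simp: act_quotient_module[OF assms] act_add_left act_add_right act_mult)
qed

end


section \<open>Growth\<close>

text \<open>A module over a monoid algebra as a vector space: scalars act through \<open>c \<mapsto> c \<cdot> 1\<close>.\<close>

definition scalar_space ::
    "('m, 'g :: monoid_add \<Rightarrow>\<^sub>0 'k :: field, 'z) right_module_scheme \<Rightarrow> ('k, 'm) module" where
  "scalar_space M =
    \<lparr>carrier = carrier M, mult = mult M, one = one M, zero = zero M, add = add M,
     smult = (\<lambda>c x. x \<triangleleft>\<^bsub>M\<^esub> Poly_Mapping.single 0 c)\<rparr>"

lemma vectorspace_scalar_space: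
  fixes M :: "('m, 'g :: monoid_add \<Rightarrow>\<^sub>0 'k :: field, 'z) right_module_scheme"
  assumes "right_module M"
  shows "vectorspace class_ring (scalar_space M)"
proof -
  interpret right_module M by fact
  have ab: "abelian_group (scalar_space M)"
  proof (rule abelian_groupI)
    fix x assume "x \<in> carrier (scalar_space M)"
    then show "\<exists>y\<in>carrier (scalar_space M). y \<oplus>\<^bsub>scalar_space M\<^esub> x = \<zero>\<^bsub>scalar_space M\<^esub>"
      by (intro bexI[of _ "\<ominus>\<^bsub>M\<^esub> x"]) (auto simp: scalar_space_def l_neg)
  qed (auto simp: scalar_space_def a_ac)
  have mult: "Poly_Mapping.single 0 (a * b) = Poly_Mapping.single (0 :: 'g) b * Poly_Mapping.single 0 a"
    for a b :: 'k
    by (simp add: mult_single mult.commute)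
  have "module (class_ring :: 'k ring) (scalar_space M)"
    by (rule moduleI[OF domain.axioms(1)[OF field.axioms(1)[OF class_field]] ab])
       (auto simp: scalar_space_def single_add act_add_left act_add_right mult act_mult)
  then show ?thesis
    by (intro vectorspace.intro class_field)
qed

definition lin_span ::
    "('m, 'g :: monoid_add \<Rightarrow>\<^sub>0 'k :: field, 'z) right_module_scheme \<Rightarrow> 'm set \<Rightarrow> 'm set" where
  "lin_span M S = LinearCombinations.module.span class_ring (scalar_space M) S"

definition lin_dim ::
    "('m, 'g :: monoid_add \<Rightarrow>\<^sub>0 'k :: field, 'z) right_module_scheme \<Rightarrow> 'm set \<Rightarrow> nat" where
  "lin_dim M W = vectorspace.dim class_ring ((scalar_space M)\<lparr>carrier := W\<rparr>)"

text \<open>The filtration \<open>R(n)\<close> of the algebra \<open>R\<close>; \<open>growth M A n\<close> below is the dimension of \<open>A R(n)\<close>.\<close>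

definition words_span :: "nat \<Rightarrow> ('g :: word_monoid \<Rightarrow>\<^sub>0 'k :: field) set" where
  "words_span n = lin_span regular_module {Poly_Mapping.single w 1 |w. word_length w \<le> n}"

definition growth ::
    "('m, 'g :: word_monoid \<Rightarrow>\<^sub>0 'k :: field, 'z) right_module_scheme \<Rightarrow> 'm set \<Rightarrow> nat \<Rightarrow> nat" where
  "growth M A n = lin_dim M (lin_span M {x \<triangleleft>\<^bsub>M\<^esub> f |x f. x \<in> A \<and> f \<in> words_span n})"

definition growth_equiv :: "(nat \<Rightarrow> nat) \<Rightarrow> (nat \<Rightarrow> nat) \<Rightarrow> bool" where
  "growth_equiv f g \<longleftrightarrow> (\<exists>C C'. \<forall>n. f n \<le> g (n + C) \<and> g n \<le> f (n + C'))"

text \<open>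
  The growth of the free module of rank 1 is represented by the growth function of the regular
  module with respect to the generator 1. That function counts the words of length at most \<open>n\<close>; for
  \<open>r > 1\<close> free generators it is equivalent to \<open>r ^ n\<close> for the free algebra and to \<open>(2 * r - 1) ^ n\<close>
  for the free group algebra.
\<close>

definition fg_maximal_growth ::
    "('m, 'g :: word_monoid \<Rightarrow>\<^sub>0 'k :: field, 'z) right_module_scheme \<Rightarrow> bool" where
  "fg_maximal_growth M \<longleftrightarrow> (\<exists>A. finite A \<and> generated_by M A \<and>
    growth_equiv (growth M A) (growth (regular_module :: ('g \<Rightarrow>\<^sub>0 'k, 'g \<Rightarrow>\<^sub>0 'k) right_module) {1}))"

definition maximal_growth ::
    "('m, 'g :: word_monoid \<Rightarrow>\<^sub>0 'k :: field, 'z) right_module_scheme \<Rightarrow> bool" where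
  "maximal_growth M \<longleftrightarrow>
    (\<exists>V. right_submodule M V \<and> fg_maximal_growth (M\<lparr>carrier := V\<rparr>))"

definition largest_nonmaximal_submodule ::
    "('m, 'g :: word_monoid \<Rightarrow>\<^sub>0 'k :: field, 'z) right_module_scheme \<Rightarrow> 'm set \<Rightarrow> bool" where
  "largest_nonmaximal_submodule M N \<longleftrightarrow>
    right_submodule M N \<and> \<not> maximal_growth (M\<lparr>carrier := N\<rparr>) \<and>
    (\<forall>L. right_submodule M L \<and> \<not> maximal_growth (M\<lparr>carrier := L\<rparr>) \<longrightarrow> L \<subseteq> N)"

end

theory Submission
  imports Defs
begin

text \<open>
  Let \<open>G(n)\<close> be the number of words of length at most \<open>n\<close>; it lies between \<open>q\<^sup>n\<close> and \<open>C q\<^sup>n\<close>, where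
  \<open>q\<close> is \<open>r\<close> or \<open>2r - 1\<close>. As \<open>A R(n + k) = A R(n) R(k)\<close>, growth functions satisfy
  \<open>g(n + k) \<le> g(n) G(k)\<close>, so that either \<open>g(n) / q\<^sup>n \<rightarrow> 0\<close> or \<open>g(n) / q\<^sup>n\<close> is bounded away from \<open>0\<close>;
  the latter is maximality. The elements of \<open>M\<close> generating a submodule of the first kind form \<open>N\<close>.

  If \<open>x + N\<close> is of the first kind in \<open>M/N\<close>, choose \<open>n\<close> such that \<open>(x + N) R(n)\<close> has dimension \<open>d\<close>, small
  compared to \<open>q\<^sup>n\<close>. Then \<open>x R(n) \<subseteq> E + B\<close> where \<open>E\<close> has dimension \<open>d\<close> and \<open>B \<subseteq> N\<close> is
  finite-dimensional, and so \<open>dim x R(n + k) \<le> d G(k) + dim B R(k)\<close>, where the last term is negligible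
  compared to \<open>q\<^sup>k\<close>. Hence \<open>x \<in> N\<close>.
\<close>

section \<open>Linear spans in modules over monoid algebras\<close>

context right_module
begin

lemma act_zero_left [simp]: "\<zero> \<triangleleft> f = \<zero>"
proof -
  have "\<zero> \<triangleleft> f = (\<zero> \<oplus> \<zero>) \<triangleleft> f" by simp
  also have "\<dots> = \<zero> \<triangleleft> f \<oplus> \<zero> \<triangleleft> f"
    by (rule act_add_left) auto
  finally show ?thesis
    by (simp add: add.r_cancel_one' act_closed)
qed

lemma act_zero_right:
  assumes "x \<in> carrier M"
  shows "x \<triangleleft> 0 = \<zero>"
  using act_add_right[OF assms, of 0 0] assms add.r_cancel_one'[of "x \<triangleleft> 0" "x \<triangleleft> 0"] by simp

lemma carrier_quotient_module: "carrier (quotient_module M N) = (+>) N ` carrier M"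
  by (auto simp: quotient_module_def A_RCOSETS_def' a_r_coset_def')

text \<open>Closure under negation follows from the action, since \<open>\<ominus> x\<close> equals
  \<open>x \<triangleleft> (- 1)\<close>.\<close>

lemma right_submoduleI:
  assumes "V \<subseteq> carrier M" "\<zero> \<in> V"
    and "\<And>x y. x \<in> V \<Longrightarrow> y \<in> V \<Longrightarrow> x \<oplus> y \<in> V" "\<And>x a. x \<in> V \<Longrightarrow> x \<triangleleft> a \<in> V"
  shows "right_submodule M V"
proof -
  have "\<ominus> x \<in> V" if "x \<in> V" for x
  proof -
    have x: "x \<in> carrier M"
      using that assms(1) by blast
    have "x \<triangleleft> (- 1) \<oplus> x = \<zero>"
      using act_add_right[OF x, of "- 1" 1] x by (simp add: act_zero_right)
    then have "\<ominus> x = x \<triangleleft> (- 1)"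
      using minus_equality x by simp
    then show ?thesis
      using assms(4) that by simp
  qed
  then have "additive_subgroup V M"
    using assms by (intro additive_subgroup.intro add.subgroupI) (auto simp: a_inv_def)
  then show ?thesis
    using assms(4) by (simp add: right_submodule_def)
qed

end

lemma scalar_space_simps [simp]:
  "carrier (scalar_space M) = carrier M" "zero (scalar_space M) = zero M"
  "add (scalar_space M) = add M"
  "smult (scalar_space M) c x = x \<triangleleft>\<^bsub>M\<^esub> Poly_Mapping.single 0 c"
  by (simp_all add: scalar_space_def)

locale monoid_algebra_module = right_module M
  for M :: "('m, 'g :: monoid_add \<Rightarrow>\<^sub>0 'k :: field, 'z) right_module_scheme" (structure)
begin

interpretation V: vectorspace "class_ring :: 'k ring" "scalar_space M"
  by (intro vectorspace_scalar_space right_module_axioms)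

lemma lin_span_subset: "S \<subseteq> carrier M \<Longrightarrow> S \<subseteq> lin_span M S"
  using V.in_own_span[of S] by (simp add: lin_span_def)

lemma submodule_lin_span: "S \<subseteq> carrier M \<Longrightarrow> submodule class_ring (lin_span M S) (scalar_space M)"
  using V.span_is_submodule[of S] by (simp add: lin_span_def)

lemma lin_span_carrier: "S \<subseteq> carrier M \<Longrightarrow> lin_span M S \<subseteq> carrier M"
  using submodule.subset[OF submodule_lin_span] by simp

lemma lin_span_zero: "S \<subseteq> carrier M \<Longrightarrow> \<zero> \<in> lin_span M S"
  using submodule.zero_closed[OF submodule_lin_span] by simp

lemma lin_span_add:
  "S \<subseteq> carrier M \<Longrightarrow> x \<in> lin_span M S \<Longrightarrow> y \<in> lin_span M S \<Longrightarrow> x \<oplus> y \<in> lin_span M S"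
  using submodule.m_closed[OF submodule_lin_span] by simp

lemma lin_span_scale:
  "S \<subseteq> carrier M \<Longrightarrow> x \<in> lin_span M S \<Longrightarrow> x \<triangleleft> Poly_Mapping.single 0 c \<in> lin_span M S"
  using submodule.smult_closed[OF submodule_lin_span, of S c x] by simp

text \<open>The elements of the carrier with property \<open>P\<close> form a subspace, and the span
  is the least subspace containing \<open>S\<close>.\<close>

lemma lin_span_induct [consumes 1, case_names subset zero add scale base]:
  assumes "x \<in> lin_span M S" "S \<subseteq> carrier M"
    and "P \<zero>"
    and "\<And>x y. x \<in> carrier M \<Longrightarrow> y \<in> carrier M \<Longrightarrow> P x \<Longrightarrow> P y \<Longrightarrow> P (x \<oplus> y)"
    and "\<And>x c. x \<in> carrier M \<Longrightarrow> P x \<Longrightarrow> P (x \<triangleleft> Poly_Mapping.single 0 c)"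
    and "\<And>x. x \<in> S \<Longrightarrow> P x"
  shows "P x"
proof -
  have "submodule class_ring {x \<in> carrier M. P x} (scalar_space M)"
    by (rule submodule.intro[OF V.module_axioms]) (auto simp: assms)
  from V.span_is_subset[OF _ this, of S] have "lin_span M S \<subseteq> {x \<in> carrier M. P x}"
    using assms(2,6) by (auto simp: lin_span_def)
  then show ?thesis
    using assms(1) by blast
qed

lemma lin_span_minimal:
  assumes "S \<subseteq> lin_span M T" "T \<subseteq> carrier M"
  shows "lin_span M S \<subseteq> lin_span M T"
  using V.span_is_subset[OF assms(1) submodule_lin_span[OF assms(2)]] by (simp add: lin_span_def)

lemma lin_span_mono: "S \<subseteq> T \<Longrightarrow> lin_span M S \<subseteq> lin_span M T"
  using V.span_is_monotone by (simp add: lin_span_def)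

section \<open>Dimensions and finite bases of spans\<close>

lemma span_submodule_eq:
  assumes "submodule class_ring W (scalar_space M)" "S \<subseteq> W"
  shows "LinearCombinations.module.span class_ring ((scalar_space M)\<lparr>carrier := W\<rparr>) S = lin_span M S"
  using V.span_li_not_depend(1)[OF assms(2,1)] by (simp add: lin_span_def)

lemma lin_dim_independent:
  assumes "finite S" "S \<subseteq> carrier M" "V.lin_indpt S"
  shows "lin_dim M (lin_span M S) = card S"
proof -
  note sub = submodule_lin_span[OF assms(2)]
  interpret W: vectorspace class_ring "(scalar_space M)\<lparr>carrier := lin_span M S\<rparr>"
    by (intro V.subspace_is_vs subspace.intro sub V.vectorspace_axioms)
  have "W.basis S"
    using assms lin_span_subset[OF assms(2)] V.span_li_not_depend(2)[OF _ sub, of S]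
    by (simp add: W.basis_def span_submodule_eq[OF sub])
  then show ?thesis
    using W.dim_basis[OF assms(1)] by (simp add: lin_dim_def)
qed

text \<open>\<open>lin_dim\<close> regards the span as a vector space of its own. Spans and
  independence of its subsets are the same in the ambient space, so a basis found there serves in
  \<open>M\<close>.\<close>

lemma lin_span_basis:
  assumes "finite S" "S \<subseteq> carrier M"
  obtains B where "finite B" "B \<subseteq> lin_span M S" "lin_span M B = lin_span M S"
    "V.lin_indpt B" "card B = lin_dim M (lin_span M S)"
proof -
  note sub = submodule_lin_span[OF assms(2)]
  interpret W: vectorspace class_ring "(scalar_space M)\<lparr>carrier := lin_span M S\<rparr>"
    by (intro V.subspace_is_vs subspace.intro sub V.vectorspace_axioms)
  have "W.fin_dim"
    unfolding W.fin_dim_def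
    using assms lin_span_subset[OF assms(2)] span_submodule_eq[OF sub]
    by (intro exI[of _ S]) auto
  then obtain B where B: "finite B" "W.basis B"
    using W.finite_basis_exists by blast
  then have BS: "B \<subseteq> lin_span M S"
    by (simp add: W.basis_def)
  show ?thesis
  proof
    show "finite B" "B \<subseteq> lin_span M S"
      by fact+
    show "lin_span M B = lin_span M S"
      using B(2) span_submodule_eq[OF sub BS] by (simp add: W.basis_def)
    show "V.lin_indpt B"
      using B(2) V.span_li_not_depend(2)[OF BS sub] by (simp add: W.basis_def)
    show "card B = lin_dim M (lin_span M S)"
      using W.dim_basis[OF B] by (simp add: lin_dim_def)
  qed
qed

lemma lin_dim_le_card:
  assumes "finite S" "S \<subseteq> carrier M" "finite T" "T \<subseteq> carrier M" "S \<subseteq> lin_span M T"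
  shows "lin_dim M (lin_span M S) \<le> card T"
proof -
  obtain B where B: "finite B" "B \<subseteq> lin_span M S" "V.lin_indpt B"
      "card B = lin_dim M (lin_span M S)"
    using lin_span_basis[OF assms(1,2)] .
  have "B \<subseteq> lin_span M T" "B \<subseteq> carrier M"
    using B(2) lin_span_minimal[OF assms(5,4)] lin_span_carrier[OF assms(2)] by blast+
  \<comment> \<open>Steinitz exchange: \<open>B\<close> is completed to a spanning set by some
    \<open>C\<close>. The bound on \<open>card C\<close> is an inequality of integers, so it forces
    \<open>card B \<le> card T\<close>.\<close>
  then have "\<exists>C. finite C \<and> C \<subseteq> carrier M \<and> C \<subseteq> lin_span M T \<and> C \<inter> B = {} \<and>
      int (card C) \<le> int (card T) - int (card B) \<and> V.span (B \<union> C) = lin_span M T"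
    using V.replacement[OF B(1) assms(3) _ B(3)] assms(4) by (simp add: lin_span_def)
  then show ?thesis
    using B(4) by auto
qed

text \<open>Scalars sit at the neutral word \<open>0\<close>, so they commute with words although
  the monoid is not commutative. Hence acting by a word is a linear map.\<close>

lemma act_single_commute:
  assumes "x \<in> carrier M"
  shows "(x \<triangleleft> Poly_Mapping.single 0 c) \<triangleleft> Poly_Mapping.single w 1
    = (x \<triangleleft> Poly_Mapping.single w 1) \<triangleleft> Poly_Mapping.single 0 c"
  using assms by (simp add: mult_single flip: act_mult)

lemma lin_span_act:
  assumes "B \<subseteq> carrier M" "x \<in> lin_span M B" "(\<lambda>b. b \<triangleleft> Poly_Mapping.single w 1) ` B \<subseteq> lin_span M T"
    "T \<subseteq> carrier M"
  shows "x \<triangleleft> Poly_Mapping.single w 1 \<in> lin_span M T"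
  using assms(2)
proof (induction rule: lin_span_induct)
  case (base x)
  with assms(3) show ?case by blast
qed (use assms(1,4) in \<open>auto simp: act_add_left act_single_commute lin_span_zero lin_span_add lin_span_scale\<close>)

end


lemma monoid_algebra_module_regular:
  "monoid_algebra_module (regular_module :: ('g :: monoid_add \<Rightarrow>\<^sub>0 'k :: field, _) right_module)"
  by (intro monoid_algebra_module.intro right_module_regular_module)

lemma regular_module_simps [simp]:
  "carrier regular_module = UNIV" "zero regular_module = 0" "add regular_module = (+)"
  "act regular_module = (*)"
  by (simp_all add: regular_module_def)

section \<open>Growth over graded word monoids\<close>

text \<open>The last two conditions give \<open>R(n + k) = R(n) R(k)\<close>; the first makes every
  \<open>R(n)\<close> finite-dimensional.\<close>

class graded_word_monoid = word_monoid +
  assumes finite_words: "finite {w. word_length w \<le> n}"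
    and word_length_plus: "word_length (u + v) \<le> word_length u + word_length v"
    and word_split: "word_length w \<le> n + k \<Longrightarrow>
      \<exists>u v. w = u + v \<and> word_length u \<le> n \<and> word_length v \<le> k"

definition word_count :: "'g :: word_monoid itself \<Rightarrow> nat \<Rightarrow> nat" where
  "word_count _ n = card {w :: 'g. word_length w \<le> n}"

text \<open>For finite \<open>A\<close> over a graded word monoid this is a finite spanning set of
  \<open>A R(n)\<close>: only words act, not all elements of \<open>words_span n\<close>.\<close>

definition translates ::
    "('m, 'g :: word_monoid \<Rightarrow>\<^sub>0 'k :: field, 'z) right_module_scheme \<Rightarrow> 'm set \<Rightarrow> nat \<Rightarrow> 'm set" where
  "translates M A n = (\<lambda>(x, w). x \<triangleleft>\<^bsub>M\<^esub> Poly_Mapping.single w 1) ` (A \<times> {w. word_length w \<le> n})"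

locale word_algebra_module = monoid_algebra_module M
  for M :: "('m, 'g :: graded_word_monoid \<Rightarrow>\<^sub>0 'k :: field, 'z) right_module_scheme" (structure)
begin

lemma translates_carrier: "A \<subseteq> carrier M \<Longrightarrow> translates M A n \<subseteq> carrier M"
  by (auto simp: translates_def)

lemma finite_translates: "finite A \<Longrightarrow> finite (translates M A n)"
  by (simp add: translates_def finite_words)

lemma card_translates_le: "finite A \<Longrightarrow> card (translates M A n) \<le> card A * word_count TYPE('g) n"
  unfolding translates_def word_count_def
  by (rule order.trans[OF card_image_le]) (simp_all add: finite_words card_cartesian_product)

lemma translatesI:
  "x \<in> A \<Longrightarrow> word_length w \<le> n \<Longrightarrow> x \<triangleleft> Poly_Mapping.single w 1 \<in> translates M A n"
  by (auto simp: translates_def)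

lemma act_words_span:
  assumes "x \<in> A" "A \<subseteq> carrier M" "f \<in> words_span n"
  shows "x \<triangleleft> f \<in> lin_span M (translates M A n)"
proof -
  interpret R: monoid_algebra_module "regular_module :: ('g \<Rightarrow>\<^sub>0 'k, 'g \<Rightarrow>\<^sub>0 'k) right_module"
    by (rule monoid_algebra_module_regular)
  note T = translates_carrier[OF assms(2), of n]
  have x: "x \<in> carrier M" using assms by blast
  from assms(3) show ?thesis
    unfolding words_span_def
  proof (induction rule: R.lin_span_induct)
    case (base f)
    then show ?case
      using lin_span_subset[OF T] translatesI[OF assms(1)] by auto
  qed (use x T in \<open>auto simp: act_zero_right act_add_right act_mult lin_span_zero lin_span_add lin_span_scale\<close>)
qed

text \<open>Words span \<open>R(n)\<close> and the action is linear in the algebra element, so the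
  products with words already span \<open>A R(n)\<close>.\<close>

lemma growth_eq:
  assumes "A \<subseteq> carrier M"
  shows "growth M A n = lin_dim M (lin_span M (translates M A n))"
proof -
  interpret R: monoid_algebra_module "regular_module :: ('g \<Rightarrow>\<^sub>0 'k, 'g \<Rightarrow>\<^sub>0 'k) right_module"
    by (rule monoid_algebra_module_regular)
  note T = translates_carrier[OF assms, of n]
  have "Poly_Mapping.single w 1 \<in> (words_span n :: ('g \<Rightarrow>\<^sub>0 'k) set)" if "word_length w \<le> n" for w
    using R.lin_span_subset[of "{Poly_Mapping.single w 1 |w. word_length w \<le> n}"] that
    by (auto simp: words_span_def)
  then have "translates M A n \<subseteq> {x \<triangleleft> f |x f. x \<in> A \<and> f \<in> words_span n}"
    by (auto simp: translates_def)
  moreover have "{x \<triangleleft> f |x f. x \<in> A \<and> f \<in> words_span n} \<subseteq> lin_span M (translates M A n)"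
    using act_words_span[OF _ assms] by auto
  ultimately have "lin_span M {x \<triangleleft> f |x f. x \<in> A \<and> f \<in> words_span n} = lin_span M (translates M A n)"
    by (intro subset_antisym lin_span_minimal[OF _ T] lin_span_mono)
  then show ?thesis
    by (simp add: growth_def)
qed

section \<open>Upper bounds for growth functions\<close>

lemma growth_le_card:
  assumes "finite A" "A \<subseteq> carrier M" "finite T" "T \<subseteq> carrier M"
    and "translates M A n \<subseteq> lin_span M T"
  shows "growth M A n \<le> card T"
  unfolding growth_eq[OF assms(2)]
  by (intro lin_dim_le_card finite_translates translates_carrier assms)

text \<open>The bound of \<open>growth_le_card\<close> is attained. Estimates can thus replace the
  space \<open>A R(n)\<close> by a finite set \<open>B\<close> of known size.\<close>

lemma growth_basis:
  assumes "finite A" "A \<subseteq> carrier M"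
  obtains B where "finite B" "B \<subseteq> carrier M" "card B = growth M A n"
    "translates M A n \<subseteq> lin_span M B"
proof -
  note T = translates_carrier[OF assms(2), of n]
  obtain B where B: "finite B" "B \<subseteq> lin_span M (translates M A n)"
      "lin_span M B = lin_span M (translates M A n)"
      "card B = lin_dim M (lin_span M (translates M A n))"
    using lin_span_basis[OF finite_translates[OF assms(1)] T] .
  show ?thesis
    by (rule that[of B]) (use B lin_span_subset[OF T] lin_span_carrier[OF T] growth_eq[OF assms(2)] in auto)
qed

text \<open>A word of length at most \<open>n + k\<close> splits into a part taking \<open>A\<close>
  into the span of \<open>B\<close> and a part of length at most \<open>k\<close>, which acts
  linearly on that span.\<close>

lemma translates_lin_span:
  assumes "translates M A n \<subseteq> lin_span M B" "A \<subseteq> carrier M" "B \<subseteq> carrier M"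
  shows "translates M A (n + k) \<subseteq> lin_span M (translates M B k)"
proof
  fix y assume "y \<in> translates M A (n + k)"
  then obtain x w where "x \<in> A" "word_length w \<le> n + k" and y: "y = x \<triangleleft> Poly_Mapping.single w 1"
    by (auto simp: translates_def)
  then obtain u v where uv: "w = u + v" "word_length u \<le> n" "word_length v \<le> k"
    using word_split by blast
  have "Poly_Mapping.single w (1 :: 'k) = Poly_Mapping.single u 1 * Poly_Mapping.single v 1"
    by (simp add: mult_single uv)
  then have "y = (x \<triangleleft> Poly_Mapping.single u 1) \<triangleleft> Poly_Mapping.single v 1"
    using \<open>x \<in> A\<close> assms(2) y by (auto simp: act_mult)
  moreover have "x \<triangleleft> Poly_Mapping.single u 1 \<in> lin_span M B"
    using assms(1) translatesI[OF \<open>x \<in> A\<close> uv(2)] by blast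
  moreover have "(\<lambda>b. b \<triangleleft> Poly_Mapping.single v 1) ` B \<subseteq> lin_span M (translates M B k)"
    using lin_span_subset[OF translates_carrier[OF assms(3)]] translatesI uv(3) by fast
  ultimately show "y \<in> lin_span M (translates M B k)"
    using lin_span_act[OF assms(3) _ _ translates_carrier[OF assms(3)]] by simp
qed

text \<open>If \<open>B\<close> has \<open>growth M A n\<close> elements and its span contains
  \<open>A R(n)\<close>, then the products of \<open>B\<close> with the words of length at most
  \<open>k\<close> have a span containing \<open>A R(n + k)\<close>.\<close>

lemma growth_add_le:
  assumes "finite A" "A \<subseteq> carrier M"
  shows "growth M A (n + k) \<le> growth M A n * word_count TYPE('g) k"
proof -
  obtain B where B: "finite B" "B \<subseteq> carrier M" "card B = growth M A n"
      "translates M A n \<subseteq> lin_span M B"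
    using growth_basis[OF assms] .
  have "growth M A (n + k) \<le> card (translates M B k)"
    using assms B by (intro growth_le_card finite_translates translates_carrier translates_lin_span)
  then show ?thesis
    using card_translates_le[OF B(1), of k] B(3) by simp
qed

lemma growth_le_word_count:
  assumes "finite A" "A \<subseteq> carrier M"
  shows "growth M A n \<le> card A * word_count TYPE('g) n"
proof -
  have "growth M A n \<le> card (translates M A n)"
    using assms by (intro growth_le_card finite_translates translates_carrier lin_span_subset)
  then show ?thesis
    using card_translates_le[OF assms(1), of n] by linarith
qed

text \<open>Spanning sets for the single generators together span \<open>A R(n)\<close>. This
  reduces questions about finite sets of generators to cyclic modules.\<close>

lemma growth_le_sum:
  assumes "finite A" "A \<subseteq> carrier M"
  shows "growth M A n \<le> (\<Sum>a\<in>A. growth M {a} n)"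
proof -
  have "\<exists>B. finite B \<and> B \<subseteq> carrier M \<and> card B = growth M {a} n \<and>
      translates M {a} n \<subseteq> lin_span M B" if "a \<in> A" for a
  proof -
    have "{a} \<subseteq> carrier M"
      using that assms(2) by blast
    from growth_basis[OF _ this, of n] show ?thesis
      by (metis finite.emptyI finite_insert)
  qed
  then obtain B where B: "\<And>a. a \<in> A \<Longrightarrow> finite (B a)" "\<And>a. a \<in> A \<Longrightarrow> B a \<subseteq> carrier M"
      "\<And>a. a \<in> A \<Longrightarrow> card (B a) = growth M {a} n"
      "\<And>a. a \<in> A \<Longrightarrow> translates M {a} n \<subseteq> lin_span M (B a)"
    by metis
  have "translates M A n \<subseteq> lin_span M (\<Union>a\<in>A. B a)"
  proof
    fix y assume "y \<in> translates M A n"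
    then obtain a w where "a \<in> A" "word_length w \<le> n" "y = a \<triangleleft> Poly_Mapping.single w 1"
      by (auto simp: translates_def)
    then have a: "a \<in> A" "y \<in> translates M {a} n"
      using translatesI[of a "{a}"] by auto
    then show "y \<in> lin_span M (\<Union>a\<in>A. B a)"
      using B(4)[OF a(1)] lin_span_mono[OF UN_upper[OF a(1), of B]] by blast
  qed
  moreover have "finite (\<Union>a\<in>A. B a)"
    using assms(1) B(1) by simp
  moreover have "(\<Union>a\<in>A. B a) \<subseteq> carrier M"
    using B(2) by (rule UN_least)
  ultimately have "growth M A n \<le> card (\<Union>a\<in>A. B a)"
    by (intro growth_le_card[OF assms])
  also have "\<dots> \<le> (\<Sum>a\<in>A. card (B a))"
    by (rule card_UN_le[OF assms(1)])
  finally show ?thesis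
    using B(3) by simp
qed

text \<open>The space \<open>(x + y) R(n)\<close> lies in \<open>x R(n) + y R(n)\<close>. The bound
  makes the elements of negligible growth closed under addition.\<close>

lemma growth_plus_le:
  assumes "x \<in> carrier M" "y \<in> carrier M"
  shows "growth M {x \<oplus> y} n \<le> growth M {x} n + growth M {y} n"
proof -
  obtain B where B: "finite B" "B \<subseteq> carrier M" "card B = growth M {x} n"
      "translates M {x} n \<subseteq> lin_span M B"
    using growth_basis[of "{x}" n] assms by auto
  obtain D where D: "finite D" "D \<subseteq> carrier M" "card D = growth M {y} n"
      "translates M {y} n \<subseteq> lin_span M D"
    using growth_basis[of "{y}" n] assms by auto
  have BD: "B \<union> D \<subseteq> carrier M" using B D by blast
  have "translates M {x \<oplus> y} n \<subseteq> lin_span M (B \<union> D)"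
  proof
    fix z assume "z \<in> translates M {x \<oplus> y} n"
    then obtain w where w: "word_length w \<le> n" "z = (x \<oplus> y) \<triangleleft> Poly_Mapping.single w 1"
      by (auto simp: translates_def)
    have "x \<triangleleft> Poly_Mapping.single w 1 \<in> lin_span M (B \<union> D)"
      using translatesI[OF _ w(1), of x "{x}"] B(4) lin_span_mono[of B "B \<union> D"] by auto
    moreover have "y \<triangleleft> Poly_Mapping.single w 1 \<in> lin_span M (B \<union> D)"
      using translatesI[OF _ w(1), of y "{y}"] D(4) lin_span_mono[of D "B \<union> D"] by auto
    ultimately show "z \<in> lin_span M (B \<union> D)"
      using w(2) assms lin_span_add[OF BD] by (simp add: act_add_left)
  qed
  then have "growth M {x \<oplus> y} n \<le> card (B \<union> D)"
    using assms B D by (intro growth_le_card) auto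
  then show ?thesis
    using card_Un_le[of B D] B(3) D(3) by linarith
qed

text \<open>The word \<open>u\<close> is absorbed into longer words and the coefficient
  \<open>c\<close> into a scalar, so only the argument of the growth function is shifted.\<close>

lemma growth_act_single_le:
  assumes "x \<in> carrier M"
  shows "growth M {x \<triangleleft> Poly_Mapping.single u c} n \<le> growth M {x} (n + word_length u)"
proof -
  obtain B where B: "finite B" "B \<subseteq> carrier M" "card B = growth M {x} (n + word_length u)"
      "translates M {x} (n + word_length u) \<subseteq> lin_span M B"
    using growth_basis[of "{x}" "n + word_length u"] assms by auto
  have "translates M {x \<triangleleft> Poly_Mapping.single u c} n \<subseteq> lin_span M B"
  proof
    fix z assume "z \<in> translates M {x \<triangleleft> Poly_Mapping.single u c} n"
    then obtain w where w: "word_length w \<le> n"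
        "z = (x \<triangleleft> Poly_Mapping.single u c) \<triangleleft> Poly_Mapping.single w 1"
      by (auto simp: translates_def)
    have "z = (x \<triangleleft> Poly_Mapping.single (u + w) 1) \<triangleleft> Poly_Mapping.single 0 c"
      using w(2) assms by (simp add: mult_single flip: act_mult)
    moreover have "x \<triangleleft> Poly_Mapping.single (u + w) 1 \<in> lin_span M B"
      using translatesI[of x "{x}" "u + w"] w(1) word_length_plus[of u w] B(4) by auto
    ultimately show "z \<in> lin_span M B"
      using lin_span_scale[OF B(2)] by simp
  qed
  then show ?thesis
    using growth_le_card[of "{x \<triangleleft> Poly_Mapping.single u c}" B n] B assms by simp
qed

text \<open>The operations are those of \<open>M\<close>, and a span of elements of \<open>V\<close>
  stays inside \<open>V\<close>, so nothing changes when it is formed in \<open>M\<close>.\<close>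

lemma growth_submodule:
  assumes "right_submodule M V" "A \<subseteq> V"
  shows "growth (M\<lparr>carrier := V\<rparr>) A n = growth M A n"
proof -
  interpret vectorspace "class_ring :: 'k ring" "scalar_space M"
    by (intro vectorspace_scalar_space right_module_axioms)
  interpret V: abelian_subgroup V M
    by (rule abelian_subgroup_right_submodule[OF assms(1)])
  let ?S = "{x \<triangleleft> f |x f. x \<in> A \<and> f \<in> words_span n}"
  have eq: "scalar_space (M\<lparr>carrier := V\<rparr>) = (scalar_space M)\<lparr>carrier := V\<rparr>"
    by (simp add: scalar_space_def)
  have sub: "submodule class_ring V (scalar_space M)"
    using assms(1) by (intro submodule.intro module_axioms) (auto simp: right_submodule_def)
  have "?S \<subseteq> V"
    using assms by (auto simp: right_submodule_def)
  then have "lin_span (M\<lparr>carrier := V\<rparr>) ?S = lin_span M ?S"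
    unfolding lin_span_def[of "M\<lparr>carrier := V\<rparr>"] eq by (rule span_submodule_eq[OF sub])
  then show ?thesis
    by (simp add: growth_def lin_dim_def eq)
qed


text \<open>Central estimate: \<open>x R(n)\<close> lies in the sum of a space of the dimension
  found in the quotient and the span of \<open>B\<close>; both are then multiplied by
  \<open>R(k)\<close>. Since \<open>B\<close> depends on \<open>n\<close> but not on
  \<open>k\<close>, one may let \<open>k\<close> grow with \<open>n\<close> fixed.\<close>

lemma growth_extension:
  assumes N: "right_submodule M N" and x: "x \<in> carrier M"
  obtains B where "finite B" "B \<subseteq> N"
    "\<And>k. growth M {x} (n + k) \<le>
      growth (quotient_module M N) {N +> x} n * word_count TYPE('g) k + growth M B k"
proof -
  let ?Q = "quotient_module M N"
  interpret N: abelian_subgroup N M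
    by (rule abelian_subgroup_right_submodule[OF N])
  interpret Q: word_algebra_module ?Q
    by (intro word_algebra_module.intro monoid_algebra_module.intro right_module_quotient_module N)
  obtain D where D: "finite D" "D \<subseteq> carrier ?Q" "card D = growth ?Q {N +> x} n"
      "translates ?Q {N +> x} n \<subseteq> lin_span ?Q D"
    using Q.growth_basis[of "{N +> x}" n] x carrier_quotient_module by auto
  \<comment> \<open>One representative is chosen per coset, so that \<open>E\<close> has as many
    elements as \<open>D\<close>.\<close>
  obtain E where E: "E \<subseteq> carrier M" "inj_on ((+>) N) E" "D = (+>) N ` E"
    using D(2) unfolding carrier_quotient_module subset_image_inj by blast
  have "finite E"
    using D(1) unfolding E(3) by (rule finite_imageD[OF _ E(2)])
  have "card E = card D"
    by (simp add: E(3) card_image[OF E(2)])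
  \<comment> \<open>Linear combinations of the cosets in \<open>D\<close> lift to the same
    combinations of the representatives in \<open>E\<close>.\<close>
  have lift: "\<exists>e\<in>lin_span M E. y = N +> e" if "y \<in> lin_span ?Q D" for y
    using that
  proof (induction rule: Q.lin_span_induct)
    case subset
    then show ?case by (rule D(2))
  next
    case zero
    show ?case
      using lin_span_zero[OF E(1)] a_coset_join2[OF _ N.a_subgroup, of \<zero>]
      by (intro bexI[of _ \<zero>]) (auto simp: quotient_module_def)
  next
    case (add y z)
    then obtain d e where de: "d \<in> lin_span M E" "y = N +> d" "e \<in> lin_span M E" "z = N +> e"
      by blast
    then have "d \<in> carrier M" "e \<in> carrier M"
      using lin_span_carrier[OF E(1)] by blast+
    then show ?case
      using N.a_rcos_sum[of d e] de lin_span_add[OF E(1)]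
      by (intro bexI[of _ "d \<oplus> e"]) (auto simp: quotient_module_def)
  next
    case (scale y c)
    then obtain e where e: "e \<in> lin_span M E" "y = N +> e"
      by blast
    then have "e \<in> carrier M"
      using lin_span_carrier[OF E(1)] by blast
    then show ?case
      using act_quotient_module[OF N] lin_span_scale[OF E(1)] e
      by (intro bexI[of _ "e \<triangleleft> Poly_Mapping.single 0 c"]) auto
  next
    case (base y)
    then show ?case
      using E(3) lin_span_subset[OF E(1)] by blast
  qed
  \<comment> \<open>The coset of \<open>z\<close> has a lift \<open>e\<close> in the span of
    \<open>E\<close>, and elements of the same coset differ by an element of
    \<open>N\<close>.\<close>
  have "\<exists>b\<in>N. \<exists>e\<in>lin_span M E. z = b \<oplus> e" if z: "z \<in> translates M {x} n" for z
  proof -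
    obtain w where w: "word_length w \<le> n" "z = x \<triangleleft> Poly_Mapping.single w 1"
      using z by (auto simp: translates_def)
    have "N +> z \<in> translates ?Q {N +> x} n"
      using Q.translatesI[of "N +> x" "{N +> x}", OF _ w(1)] w(2) act_quotient_module[OF N x] by simp
    then obtain e where "e \<in> lin_span M E" "N +> z = N +> e"
      using D(4) lift by blast
    moreover have "z \<in> N +> z"
      by (rule N.a_rcos_self) (use w x in simp)
    ultimately show ?thesis
      by (auto simp: a_r_coset_def')
  qed
  then obtain b where b: "\<And>z. z \<in> translates M {x} n \<Longrightarrow> b z \<in> N"
      "\<And>z. z \<in> translates M {x} n \<Longrightarrow> \<exists>e\<in>lin_span M E. z = b z \<oplus> e"
    by metis
  \<comment> \<open>Taking only the finitely many differences \<open>z - e\<close> avoids intersecting \<open>N\<close> with the span of the translates.\<close>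
  define B where "B = b ` translates M {x} n"
  have B: "finite B" "B \<subseteq> N" "B \<subseteq> carrier M"
    using b(1) N.a_subset finite_translates[of "{x}" n] by (auto simp: B_def)
  have EB: "E \<union> B \<subseteq> carrier M"
    using E(1) B(3) by blast
  have base: "translates M {x} n \<subseteq> lin_span M (E \<union> B)"
  proof
    fix z assume z: "z \<in> translates M {x} n"
    then obtain e where e: "e \<in> lin_span M E" "z = b z \<oplus> e"
      using b(2) by blast
    moreover have "e \<in> lin_span M (E \<union> B)"
      using e(1) lin_span_mono[of E "E \<union> B"] by blast
    moreover have "b z \<in> lin_span M (E \<union> B)"
      using z lin_span_subset[OF EB] by (auto simp: B_def)
    ultimately show "z \<in> lin_span M (E \<union> B)"
      using lin_span_add[OF EB] by metis
  qed
  have "growth M {x} (n + k) \<le> growth ?Q {N +> x} n * word_count TYPE('g) k + growth M B k" for k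
  proof -
    obtain F where F: "finite F" "F \<subseteq> carrier M" "card F = growth M B k"
        "translates M B k \<subseteq> lin_span M F"
      using growth_basis[OF B(1,3)] .
    \<comment> \<open>The products of \<open>E\<close> are counted crudely, by the number of words;
      for \<open>B\<close> the true growth function is kept, as it is what becomes small in the
      application.\<close>
    let ?T = "translates M E k \<union> F"
    have T: "finite ?T" "?T \<subseteq> carrier M"
      using F \<open>finite E\<close> E(1) finite_translates translates_carrier by blast+
    have "translates M (E \<union> B) k = translates M E k \<union> translates M B k"
      by (auto simp: translates_def)
    also have "\<dots> \<subseteq> lin_span M ?T"
      using lin_span_subset[OF T(2)] F(4) lin_span_mono[of F ?T] by blast
    finally have "lin_span M (translates M (E \<union> B) k) \<subseteq> lin_span M ?T"
      by (rule lin_span_minimal[OF _ T(2)])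
    then have "translates M {x} (n + k) \<subseteq> lin_span M ?T"
      using translates_lin_span[OF base _ EB, of k] x by blast
    then have "growth M {x} (n + k) \<le> card ?T"
      by (intro growth_le_card T) (use x in auto)
    also have "\<dots> \<le> card E * word_count TYPE('g) k + growth M B k"
      using card_Un_le[of "translates M E k" F] card_translates_le[OF \<open>finite E\<close>, of k] F(3) by linarith
    finally show ?thesis
      using \<open>card E = card D\<close> D(3) by simp
  qed
  with B(1,2) show ?thesis
    by (rule that)
qed

end

text \<open>The translates of 1 are the words, which are linearly independent in the monoid
  algebra.\<close>

lemma growth_regular:
  "growth (regular_module :: ('g :: graded_word_monoid \<Rightarrow>\<^sub>0 'k :: field, _) right_module) {1} n
    = word_count TYPE('g) n"
proof -
  let ?R = "regular_module :: ('g \<Rightarrow>\<^sub>0 'k, 'g \<Rightarrow>\<^sub>0 'k) right_module"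
  let ?W = "{w :: 'g. word_length w \<le> n}"
  let ?s = "\<lambda>w :: 'g. Poly_Mapping.single w (1 :: 'k)"
  interpret R: word_algebra_module ?R
    by (intro word_algebra_module.intro monoid_algebra_module_regular)
  interpret V: vectorspace "class_ring :: 'k ring" "scalar_space ?R"
    by (intro vectorspace_scalar_space right_module_regular_module)
  have T: "translates ?R {1} n = ?s ` ?W"
    by (force simp: translates_def image_iff)
  have inj: "inj_on ?s A" for A
    by (rule inj_onI) (metis lookup_single_eq lookup_single_not_eq zero_neq_one)
  have finsum: "finsum (scalar_space ?R) f A = sum f A" if "finite A" for f A
    using that by (induction A) (auto simp: V.finsum_insert)
  have "V.lin_indpt (?s ` ?W)"
  proof (rule V.finite_lin_indpt2)
    fix a :: "('g \<Rightarrow>\<^sub>0 'k) \<Rightarrow> 'k"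
    assume "V.lincomb a (?s ` ?W) = \<zero>\<^bsub>scalar_space ?R\<^esub>"
    then have "(\<Sum>w\<in>?W. Poly_Mapping.single w (a (?s w))) = 0"
      by (simp add: V.lincomb_def finsum finite_words sum.reindex inj mult_single)
    \<comment> \<open>Taking the coefficient at \<open>v\<close> isolates the single term
      \<open>w = v\<close>.\<close>
    then have "(\<Sum>w\<in>?W. Poly_Mapping.lookup (Poly_Mapping.single w (a (?s w))) v) = 0" for v :: 'g
      by (simp flip: lookup_sum)
    then have *: "(if word_length v \<le> n then a (?s v) else 0) = 0" for v
      by (simp add: lookup_single when_def finite_words)
    have "a (?s v) = 0" if "word_length v \<le> n" for v
      using *[of v] that by simp
    then show "\<forall>v\<in>?s ` ?W. a v = \<zero>\<^bsub>class_ring\<^esub>"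
      by auto
  qed (auto simp: finite_words)
  then have "lin_dim ?R (lin_span ?R (?s ` ?W)) = card (?s ` ?W)"
    by (intro R.lin_dim_independent) (auto simp: finite_words)
  then show ?thesis
    by (simp add: R.growth_eq T word_count_def card_image inj)
qed


section \<open>Negligible and maximal growth\<close>

text \<open>This is \<open>f(n) = o(q ^ n)\<close>. It passes to sums, smaller functions and shifts,
  as membership in a submodule requires.\<close>

definition negligible :: "nat \<Rightarrow> (nat \<Rightarrow> nat) \<Rightarrow> bool" where
  "negligible q f \<longleftrightarrow> (\<lambda>n. real (f n) / real q ^ n) \<longlonglongrightarrow> 0"

lemma negligible_less:
  assumes "negligible q f" "q > 0" "e > 0"
  obtains n where "real (f n) < e * real q ^ n"
proof -
  obtain n where "norm (real (f n) / real q ^ n - 0) < e"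
    using LIMSEQ_D[OF assms(1)[unfolded negligible_def] assms(3)] by blast
  then have "real (f n) < e * real q ^ n"
    using assms(2) by (simp add: divide_less_eq)
  then show ?thesis
    by (rule that)
qed

lemma negligible_mono:
  assumes "negligible q g" "\<And>n. f n \<le> g n"
  shows "negligible q f"
  unfolding negligible_def
  by (rule real_tendsto_sandwich[OF _ _ tendsto_const assms(1)[unfolded negligible_def]])
     (auto intro!: always_eventually divide_right_mono assms(2))

lemma negligible_sum:
  "(\<And>a. a \<in> A \<Longrightarrow> negligible q (f a)) \<Longrightarrow> negligible q (\<lambda>n. \<Sum>a\<in>A. f a n)"
  unfolding negligible_def using tendsto_sum[of A "\<lambda>a n. real (f a n) / real q ^ n" "\<lambda>_. 0"]
  by (simp add: sum_divide_distrib)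

lemma negligible_add: "negligible q f \<Longrightarrow> negligible q g \<Longrightarrow> negligible q (\<lambda>n. f n + g n)"
  unfolding negligible_def
  using tendsto_add[of "\<lambda>n. real (f n) / real q ^ n" 0 _ "\<lambda>n. real (g n) / real q ^ n" 0]
  by (simp add: add_divide_distrib)

lemma negligible_shift:
  assumes "negligible q f" "q > 0"
  shows "negligible q (\<lambda>n. f (n + d))"
proof -
  \<comment> \<open>The shifted quotient is \<open>q ^ d\<close> times a tail of the original
    sequence.\<close>
  have "(\<lambda>n. real q ^ d * (real (f (n + d)) / real q ^ (n + d))) \<longlonglongrightarrow> real q ^ d * 0"
    using assms(1) unfolding negligible_def
    by (intro tendsto_mult tendsto_const LIMSEQ_ignore_initial_segment)
  then show ?thesis
    using assms(2) by (simp add: negligible_def power_add)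
qed

text \<open>What the argument uses about the two algebras: the number of words is
  \<open>q ^ n\<close> up to a constant factor. Only the word monoid is constrained, so the
  assumptions pass to submodules and quotients of \<open>M\<close>.\<close>

locale exponential_growth_module = word_algebra_module M
  for M :: "('m, 'g :: graded_word_monoid \<Rightarrow>\<^sub>0 'k :: field, 'z) right_module_scheme" (structure) +
  fixes q C :: nat
  assumes q: "2 \<le> q"
    and word_count_ge: "q ^ n \<le> word_count TYPE('g) n"
    and word_count_le: "word_count TYPE('g) n \<le> C * q ^ n"
begin

lemma C_pos: "C > 0"
  using word_count_ge[of 0] word_count_le[of 0] by simp

text \<open>Allows a constant factor \<open>c\<close> to be traded for a shift by \<open>c\<close>
  in growth equivalence.\<close>

lemma le_power: "c \<le> q ^ c"
  using q by (metis less_exp less_imp_le order.trans power_mono zero_le)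

text \<open>Once the growth at \<open>n\<close> is below \<open>r / C * q ^ n\<close>,
  \<open>growth_add_le\<close> keeps it below \<open>r * q ^ m\<close> for all
  \<open>m \<ge> n\<close>. Without a positive lower bound this happens for every
  \<open>r > 0\<close>, and the quotients tend to 0.\<close>

lemma growth_lower_bound:
  assumes "finite A" "A \<subseteq> carrier M" "\<not> negligible q (growth M A)"
  shows "\<exists>e>0. \<forall>n. e * real q ^ n \<le> real (growth M A n)"
proof (rule ccontr)
  assume *: "\<not> ?thesis"
  have "negligible q (growth M A)"
    unfolding negligible_def
  proof (rule LIMSEQ_I)
    fix r :: real assume "r > 0"
    then have "r / C > 0"
      using C_pos by simp
    with * obtain n where n: "real (growth M A n) < r / C * real q ^ n"
      by (meson not_le)
    have "norm (real (growth M A m) / real q ^ m - 0) < r" if le: "n \<le> m" for m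
    proof -
      obtain k where m: "m = n + k"
        using le_Suc_ex[OF le] by blast
      have "growth M A m \<le> growth M A n * word_count TYPE('g) k"
        unfolding m by (rule growth_add_le[OF assms(1,2)])
      also have "\<dots> \<le> growth M A n * (C * q ^ k)"
        by (intro mult_left_mono word_count_le) simp
      finally have "real (growth M A m) \<le> real (growth M A n) * (real C * real q ^ k)"
        by (metis of_nat_le_iff of_nat_mult of_nat_power)
      also have "\<dots> < r / C * real q ^ n * (real C * real q ^ k)"
        using n C_pos q by (intro mult_strict_right_mono) auto
      also have "\<dots> = r * real q ^ m"
        using C_pos by (simp add: m power_add)
      finally show ?thesis
        using q by (simp add: divide_less_eq)
    qed
    then show "\<exists>n0. \<forall>m\<ge>n0. norm (real (growth M A m) / real q ^ m - 0) < r"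
      by blast
  qed
  with assms(3) show False
    by blast
qed

lemma growth_equiv_iff:
  assumes "finite A" "A \<subseteq> carrier M"
  shows "growth_equiv (growth M A) (growth (regular_module :: ('g \<Rightarrow>\<^sub>0 'k, 'g \<Rightarrow>\<^sub>0 'k) right_module) {1})
    \<longleftrightarrow> \<not> negligible q (growth M A)" (is "growth_equiv ?g ?r \<longleftrightarrow> _")
proof
  have r: "?r n = word_count TYPE('g) n" for n
    by (rule growth_regular)
  show "\<not> negligible q ?g" if equiv: "growth_equiv ?g ?r"
  proof
    assume "negligible q ?g"
    from equiv obtain d where d: "\<And>n. word_count TYPE('g) n \<le> ?g (n + d)"
      unfolding growth_equiv_def r by blast
    have "negligible q (\<lambda>n. ?g (n + d))"
      using \<open>negligible q ?g\<close> q by (intro negligible_shift) auto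
    \<comment> \<open>The number of words is at least \<open>q ^ n\<close> and at most the shifted
      growth. This is absurd, as the quotient of \<open>q ^ n\<close> by itself is constantly
      1.\<close>
    then have "negligible q (\<lambda>n. q ^ n)"
      by (rule negligible_mono) (use word_count_ge d order.trans in blast)
    then have "(\<lambda>n. 1 :: real) \<longlonglongrightarrow> 0"
      using q by (simp add: negligible_def)
    then show False
      by (simp add: LIMSEQ_const_iff)
  qed
  show "growth_equiv ?g ?r" if not_negl: "\<not> negligible q ?g"
  proof -
    obtain e where e: "e > 0" "\<And>n. e * real q ^ n \<le> real (?g n)"
      using growth_lower_bound[OF assms not_negl] by blast
    \<comment> \<open>The growth exceeds \<open>q ^ n\<close> by at most the factor
      \<open>card A * C\<close>, which \<open>le_power\<close> turns into a shift.\<close>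
    have "?g n \<le> ?r (n + card A * C)" for n
    proof -
      have "?g n \<le> card A * word_count TYPE('g) n"
        by (rule growth_le_word_count[OF assms])
      also have "\<dots> \<le> card A * (C * q ^ n)"
        by (intro mult_left_mono word_count_le) simp
      also have "\<dots> \<le> q ^ (card A * C) * q ^ n"
        using le_power[of "card A * C"] by (simp flip: mult.assoc)
      also have "\<dots> \<le> word_count TYPE('g) (n + card A * C)"
        using word_count_ge by (simp add: power_add mult.commute flip: power_add)
      finally show ?thesis
        by (simp add: r)
    qed
    \<comment> \<open>The shift has to make up for the factor \<open>C / e\<close>, and
      \<open>q ^ d\<close> is at least \<open>d\<close>.\<close>
    moreover have "?r n \<le> ?g (n + nat \<lceil>C / e\<rceil>)" for n
    proof -
      let ?d = "nat \<lceil>C / e\<rceil>"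
      have "C / e \<le> real ?d"
        by (rule real_nat_ceiling_ge)
      also have "\<dots> \<le> real q ^ ?d"
        using le_power[of ?d] by (metis of_nat_le_iff of_nat_power)
      finally have "real C \<le> e * real q ^ ?d"
        using e(1) by (simp add: field_simps)
      then have "real C * real q ^ n \<le> e * real q ^ ?d * real q ^ n"
        by (intro mult_right_mono) auto
      also have "\<dots> = e * real q ^ (n + ?d)"
        by (simp add: power_add)
      also have "\<dots> \<le> real (?g (n + ?d))"
        by (rule e(2))
      finally have "C * q ^ n \<le> ?g (n + ?d)"
        by (metis of_nat_le_iff of_nat_mult of_nat_power)
      then show ?thesis
        using word_count_le[of n] by (simp add: r)
    qed
    ultimately show ?thesis
      unfolding growth_equiv_def by blast
  qed
qed

text \<open>Cyclic submodules suffice: if all generators are negligible, so is the sum of their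
  growth functions; conversely, an \<open>x\<close> that is not negligible generates a submodule
  \<open>x R\<close> of maximal growth.\<close>

lemma maximal_growth_iff:
  "maximal_growth M \<longleftrightarrow> (\<exists>x\<in>carrier M. \<not> negligible q (growth M {x}))"
proof
  assume "maximal_growth M"
  then obtain V A where V: "right_submodule M V" and A: "finite A" "generated_by (M\<lparr>carrier := V\<rparr>) A"
      and equiv: "growth_equiv (growth (M\<lparr>carrier := V\<rparr>) A)
        (growth (regular_module :: ('g \<Rightarrow>\<^sub>0 'k, 'g \<Rightarrow>\<^sub>0 'k) right_module) {1})"
    unfolding maximal_growth_def fg_maximal_growth_def by blast
  interpret V: abelian_subgroup V M
    by (rule abelian_subgroup_right_submodule[OF V])
  have AV: "A \<subseteq> V"
    using A(2) by (simp add: generated_by_def)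
  then have AM: "A \<subseteq> carrier M"
    using V.a_subset by blast
  have "growth (M\<lparr>carrier := V\<rparr>) A = growth M A"
    using growth_submodule[OF V AV] by blast
  then have "\<not> negligible q (growth M A)"
    using equiv growth_equiv_iff[OF A(1) AM] by simp
  then have "\<not> negligible q (\<lambda>n. \<Sum>a\<in>A. growth M {a} n)"
    using negligible_mono growth_le_sum[OF A(1) AM] by blast
  then show "\<exists>x\<in>carrier M. \<not> negligible q (growth M {x})"
    using negligible_sum[of A q "\<lambda>a. growth M {a}"] AM by blast
next
  assume "\<exists>x\<in>carrier M. \<not> negligible q (growth M {x})"
  then obtain x where x: "x \<in> carrier M" "\<not> negligible q (growth M {x})"
    by blast
  let ?V = "range (\<lambda>a. x \<triangleleft> a)"
  have xV: "x \<in> ?V"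
    using act_one[OF x(1)] by (metis rangeI)
  have V: "right_submodule M ?V"
    using x act_zero_right[OF x(1)]
    by (intro right_submoduleI) (auto simp flip: act_add_right act_mult act_zero_right[OF x(1)])
  then interpret V: right_module "M\<lparr>carrier := ?V\<rparr>"
    by (rule right_module_submodule)
  \<comment> \<open>The intersection in \<open>generated_by\<close> is contained in
    \<open>?V\<close> because \<open>?V\<close> is itself one of the intersected submodules.\<close>
  have "right_submodule (M\<lparr>carrier := ?V\<rparr>) ?V"
    by (rule V.right_submoduleI) (use V.zero_closed V.a_closed V.act_closed in auto)
  then have "generated_by (M\<lparr>carrier := ?V\<rparr>) {x}"
    using xV by (auto simp: generated_by_def right_submodule_def)
  moreover have "growth (M\<lparr>carrier := ?V\<rparr>) {x} = growth M {x}"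
    using growth_submodule[OF V] xV by blast
  ultimately show "maximal_growth M"
    using V growth_equiv_iff[of "{x}"] x
    unfolding maximal_growth_def fg_maximal_growth_def by (intro exI[of _ ?V]) auto
qed


lemma exponential_growth_submodule:
  "right_submodule M V \<Longrightarrow> exponential_growth_module (M\<lparr>carrier := V\<rparr>) q C"
  by (intro exponential_growth_module.intro word_algebra_module.intro monoid_algebra_module.intro
      right_module_submodule exponential_growth_module_axioms.intro q word_count_ge word_count_le)

lemma exponential_growth_quotient:
  "right_submodule M V \<Longrightarrow> exponential_growth_module (quotient_module M V) q C"
  by (intro exponential_growth_module.intro word_algebra_module.intro monoid_algebra_module.intro
      right_module_quotient_module exponential_growth_module_axioms.intro q word_count_ge word_count_le)

lemma maximal_growth_submodule_iff:
  assumes "right_submodule M V"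
  shows "maximal_growth (M\<lparr>carrier := V\<rparr>) \<longleftrightarrow> (\<exists>x\<in>V. \<not> negligible q (growth M {x}))"
proof -
  have "growth (M\<lparr>carrier := V\<rparr>) {x} = growth M {x}" if "x \<in> V" for x
    using growth_submodule[OF assms] that by blast
  then show ?thesis
    using exponential_growth_module.maximal_growth_iff[OF exponential_growth_submodule[OF assms]] by simp
qed

section \<open>The submodule of negligible elements\<close>

definition negligible_part :: "'m set" where
  "negligible_part = {x \<in> carrier M. negligible q (growth M {x})}"

lemma negligible_part_carrier: "negligible_part \<subseteq> carrier M"
  by (auto simp: negligible_part_def)

lemma negligible_part_add:
  assumes "x \<in> negligible_part" "y \<in> negligible_part"
  shows "x \<oplus> y \<in> negligible_part"
  using assms negligible_mono[OF negligible_add growth_plus_le]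
  by (auto simp: negligible_part_def)

lemma negligible_part_act_single:
  assumes "x \<in> negligible_part"
  shows "x \<triangleleft> Poly_Mapping.single u c \<in> negligible_part"
proof -
  have x: "x \<in> carrier M" "negligible q (growth M {x})"
    using assms by (auto simp: negligible_part_def)
  then have "negligible q (\<lambda>n. growth M {x} (n + word_length u))"
    using q by (intro negligible_shift) auto
  then show ?thesis
    using negligible_mono[OF _ growth_act_single_le] x by (simp add: negligible_part_def)
qed

lemma negligible_part_act:
  assumes "x \<in> negligible_part"
  shows "x \<triangleleft> f \<in> negligible_part"
proof (induction f rule: update_induct)
  case const
  show ?case
    using negligible_part_act_single[OF assms, of 0 0] by simp
next
  case (update f u c)
  \<comment> \<open>As \<open>u\<close> lies outside the support of \<open>f\<close>, the update
    adds a monomial; the induction thus builds \<open>f\<close> from monomials.\<close>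
  have "Poly_Mapping.update u c f = f + Poly_Mapping.single u c"
    using update(1) by (intro poly_mapping_eqI) (auto simp: lookup_update lookup_add lookup_single when_def in_keys_iff)
  then show ?case
    using update(3) negligible_part_add negligible_part_act_single[OF assms] assms negligible_part_carrier
    by (auto simp: act_add_right)
qed

lemma right_submodule_negligible_part: "right_submodule M negligible_part"
proof (rule right_submoduleI)
  have "negligible q (growth M {\<zero>})"
  proof -
    \<comment> \<open>The space \<open>\<zero> R(n)\<close> is zero, hence spanned by the empty
      set.\<close>
    have "growth M {\<zero>} n \<le> card ({} :: 'm set)" for n
      by (rule growth_le_card) (auto simp: translates_def lin_span_zero)
    then show ?thesis
      by (simp add: negligible_def)
  qed
  then show "\<zero> \<in> negligible_part"
    by (simp add: negligible_part_def)
qed (use negligible_part_carrier negligible_part_add negligible_part_act in auto)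

text \<open>The growth of a submodule is not maximal exactly when all its elements are negligible,
  that is, when it lies in \<open>negligible_part\<close>.\<close>

lemma largest_nonmaximal_negligible_part: "largest_nonmaximal_submodule M negligible_part"
  unfolding largest_nonmaximal_submodule_def
proof (intro conjI allI impI)
  show "right_submodule M negligible_part"
    by (rule right_submodule_negligible_part)
  then show "\<not> maximal_growth (M\<lparr>carrier := negligible_part\<rparr>)"
    by (auto simp: maximal_growth_submodule_iff negligible_part_def)
  fix L assume L: "right_submodule M L \<and> \<not> maximal_growth (M\<lparr>carrier := L\<rparr>)"
  then interpret L: abelian_subgroup L M
    by (intro abelian_subgroup_right_submodule) simp
  show "L \<subseteq> negligible_part"
    using L L.a_subset by (auto simp: maximal_growth_submodule_iff negligible_part_def)
qed

text \<open>The choices are made in the order \<open>n\<close>, \<open>B\<close>, \<open>k\<close>: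
  first the quotient term and then the term of \<open>B\<close> is brought down to half of the lower
  bound for \<open>x\<close>.\<close>

lemma quotient_not_negligible:
  assumes "x \<in> carrier M" "x \<notin> negligible_part"
  shows "\<not> negligible q (growth (quotient_module M negligible_part) {negligible_part +> x})"
    (is "\<not> negligible q ?h")
proof
  assume h: "negligible q ?h"
  have "\<not> negligible q (growth M {x})"
    using assms by (simp add: negligible_part_def)
  then obtain e :: real where e: "e > 0" "\<And>n. e * real q ^ n \<le> real (growth M {x} n)"
    using growth_lower_bound[of "{x}"] assms(1) by auto
  \<comment> \<open>The \<open>C\<close> in the denominator cancels the one in
    \<open>word_count_le\<close>, which leaves half of \<open>e\<close>.\<close>
  obtain n where n: "real (?h n) < e / (2 * C) * real q ^ n"
    by (rule negligible_less[OF h, where e = "e / (2 * C)"]) (use q e(1) C_pos in auto)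
  obtain B where B: "finite B" "B \<subseteq> negligible_part"
    "\<And>k. growth M {x} (n + k) \<le> ?h n * word_count TYPE('g) k + growth M B k"
    using growth_extension[OF right_submodule_negligible_part assms(1)] by metis
  have BM: "B \<subseteq> carrier M"
    using B(2) negligible_part_carrier by blast
  have "negligible q (\<lambda>k. \<Sum>b\<in>B. growth M {b} k)"
    using B(2) by (intro negligible_sum) (auto simp: negligible_part_def)
  then have "negligible q (growth M B)"
    using negligible_mono growth_le_sum[OF B(1) BM] by blast
  \<comment> \<open>Smallness against \<open>q ^ k\<close> is enough, as
    \<open>q ^ k \<le> q ^ (n + k)\<close>.\<close>
  then obtain k where k: "real (growth M B k) < e / 2 * real q ^ k"
    by (rule negligible_less[where e = "e / 2"]) (use q e(1) in auto)
  have "real (?h n) * real (word_count TYPE('g) k) \<le> e / (2 * C) * real q ^ n * (real C * real q ^ k)"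
  proof (rule mult_mono)
    show "real (word_count TYPE('g) k) \<le> real C * real q ^ k"
      using word_count_le[of k] by (metis of_nat_le_iff of_nat_mult of_nat_power)
  qed (use n e(1) in auto)
  also have "\<dots> = e / 2 * real q ^ (n + k)"
    using C_pos by (simp add: power_add)
  finally have "real (?h n) * real (word_count TYPE('g) k) \<le> e / 2 * real q ^ (n + k)" .
  moreover have "e / 2 * real q ^ k \<le> e / 2 * real q ^ (n + k)"
    using q e(1) by (intro mult_left_mono power_increasing) auto
  moreover have "real (growth M {x} (n + k)) \<le> real (?h n) * real (word_count TYPE('g) k) + real (growth M B k)"
    using B(3)[of k] by (metis of_nat_add of_nat_le_iff of_nat_mult)
  ultimately have "real (growth M {x} (n + k)) < e * real q ^ (n + k)"
    using k by linarith
  with e(2)[of "n + k"] show False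
    by linarith
qed

theorem nonmaximal_radical:
  "\<exists>N. largest_nonmaximal_submodule M N \<and>
    (\<forall>L. right_submodule (quotient_module M N) L \<and> L \<noteq> {\<zero>\<^bsub>quotient_module M N\<^esub>} \<longrightarrow>
      maximal_growth ((quotient_module M N)\<lparr>carrier := L\<rparr>))"
proof (intro exI[of _ negligible_part] conjI allI impI largest_nonmaximal_negligible_part)
  let ?N = negligible_part
  let ?Q = "quotient_module M ?N"
  fix L assume L: "right_submodule ?Q L \<and> L \<noteq> {\<zero>\<^bsub>?Q\<^esub>}"
  interpret N: abelian_subgroup ?N M
    by (rule abelian_subgroup_right_submodule[OF right_submodule_negligible_part])
  interpret Q: exponential_growth_module ?Q q C
    by (rule exponential_growth_quotient[OF right_submodule_negligible_part])
  interpret L: abelian_subgroup L ?Q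
    by (rule Q.abelian_subgroup_right_submodule) (use L in simp)
  obtain y where y: "y \<in> L" "y \<noteq> \<zero>\<^bsub>?Q\<^esub>"
    using L L.zero_closed by blast
  then obtain x where x: "x \<in> carrier M" "y = ?N +> x"
    using L.a_subset unfolding carrier_quotient_module by blast
  \<comment> \<open>A representative in \<open>?N\<close> would make \<open>y\<close> the zero
    coset.\<close>
  have "x \<notin> ?N"
    using y(2) x N.a_rcos_const by (auto simp: quotient_module_def)
  then have "\<not> negligible q (growth ?Q {y})"
    using quotient_not_negligible x by simp
  then show "maximal_growth (?Q\<lparr>carrier := L\<rparr>)"
    using Q.maximal_growth_submodule_iff L y(1) by blast
qed

end

section \<open>Counting words\<close>

text \<open>Here \<open>s i\<close> will be the number of words of length exactly \<open>i\<close>.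
  As \<open>q \<ge> 2\<close>, the sum is of the order of its last term; the factor 2 leaves room
  for the reduced words.\<close>

lemma word_count_bounds:
  fixes s :: "nat \<Rightarrow> nat"
  assumes "2 \<le> q" "\<And>i. q ^ i \<le> s i" "\<And>i. s i \<le> 2 * q ^ i"
  shows "q ^ n \<le> (\<Sum>i\<le>n. s i)" "(\<Sum>i\<le>n. s i) \<le> 4 * q ^ n"
proof -
  show "q ^ n \<le> (\<Sum>i\<le>n. s i)"
    using assms(2)[of n] member_le_sum[of n "{..n}" s] by simp
  show "(\<Sum>i\<le>n. s i) \<le> 4 * q ^ n"
  proof (induction n)
    case (Suc n)
    \<comment> \<open>The bound \<open>4 * q ^ n\<close> is split so that
      \<open>2 * q ^ n \<le> q ^ Suc n\<close> applies and the constant is again 2 + 2.\<close>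
    then have "(\<Sum>i\<le>Suc n. s i) \<le> 2 * (2 * q ^ n) + 2 * q ^ Suc n"
      using assms(3)[of "Suc n"] by simp
    also have "2 * q ^ n \<le> q ^ Suc n"
      using assms(1) by simp
    finally show ?case
      by simp
  qed (use assms(3)[of 0] in simp)
qed

section \<open>Words in the free monoid\<close>

lemma bij_betw_free_monoid:
  "bij_betw Rep_free_monoid {w. word_length w \<le> n} {xs. length xs \<le> n}"
  by (rule bij_betw_byWitness[where f' = Abs_free_monoid])
     (auto simp: word_length_free_monoid.rep_eq Rep_free_monoid_inverse Abs_free_monoid_inverse)

instance free_monoid :: (finite) graded_word_monoid
proof
  fix n k and u v w :: "'a free_monoid"
  show "finite {w :: 'a free_monoid. word_length w \<le> n}"
    using bij_betw_finite[OF bij_betw_free_monoid[where 'a = 'a]] finite_lists_length_le[of "UNIV :: 'a set" n] by simp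
  show "word_length (u + v) \<le> word_length u + word_length v"
    by transfer simp
  show "\<exists>u v. w = u + v \<and> word_length u \<le> n \<and> word_length v \<le> k" if "word_length w \<le> n + k"
    using that
  proof (transfer fixing: n k)
    fix w :: "'a list" assume "length w \<le> n + k"
    then show "\<exists>u v. w = u @ v \<and> length u \<le> n \<and> length v \<le> k"
      by (intro exI[of _ "take n w"] exI[of _ "drop n w"]) auto
  qed
qed

lemma word_count_free_monoid:
  "word_count TYPE('x :: finite free_monoid) n = (\<Sum>i\<le>n. card (UNIV :: 'x set) ^ i)"
  using bij_betw_same_card[OF bij_betw_free_monoid[where 'a = 'x], of n] card_lists_length_le[of "UNIV :: 'x set" n]
  by (simp add: word_count_def)

section \<open>Reduced words in the free group\<close>

lemma bij_betw_free_group: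
  "bij_betw Rep_free_group {w. word_length w \<le> n} {xs. reduced xs \<and> length xs \<le> n}"
  by (rule bij_betw_byWitness[where f' = Abs_free_group])
     (use Rep_free_group in \<open>auto simp: word_length_free_group.rep_eq Rep_free_group_inverse Abs_free_group_inverse\<close>)

lemma length_foldr_reduced_Cons: "length (foldr reduced_Cons u v) \<le> length u + length v"
  by (induction u) (auto simp: reduced_Cons_def)

text \<open>No cancellation occurs at a cut in a reduced word. This yields the splitting of words in
  the free group.\<close>

lemma reduced_append:
  "reduced (u @ v) \<Longrightarrow> reduced u \<and> reduced v \<and> foldr reduced_Cons u v = u @ v"
  by (induction u) (auto simp: reduced_Cons_iff reduced_Cons_def hd_append split: if_splits)

instance free_group :: (finite) graded_word_monoid
proof
  fix n k and u v w :: "'a free_group"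
  show "finite {w :: 'a free_group. word_length w \<le> n}"
    using bij_betw_finite[OF bij_betw_free_group[where 'a = 'a]]
      finite_subset[OF _ finite_lists_length_le[of "UNIV :: ('a \<times> bool) set" n]] by auto
  show "word_length (u + v) \<le> word_length u + word_length v"
    by transfer (rule length_foldr_reduced_Cons)
  show "\<exists>u v. w = u + v \<and> word_length u \<le> n \<and> word_length v \<le> k" if "word_length w \<le> n + k"
    using that
  proof (transfer fixing: n k)
    fix w :: "('a \<times> bool) list" assume "reduced w" "length w \<le> n + k"
    then show "\<exists>u\<in>{w. reduced w}. \<exists>v\<in>{w. reduced w}.
        w = foldr reduced_Cons u v \<and> length u \<le> n \<and> length v \<le> k"
      using reduced_append[of "take n w" "drop n w"]
      by (intro bexI[of _ "take n w"] bexI[of _ "drop n w"]) auto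
  qed
qed

definition reduced_words :: "nat \<Rightarrow> ('x \<times> bool) list set" where
  "reduced_words n = {w. reduced w \<and> length w = n}"

lemma finite_reduced_words: "finite (reduced_words n :: ('x :: finite \<times> bool) list set)"
  by (rule finite_subset[OF _ finite_lists_length_le[of UNIV n]]) (auto simp: reduced_words_def)

lemma card_letters: "card (UNIV :: ('x :: finite \<times> bool) set) = 2 * card (UNIV :: 'x set)"
  by (simp add: card_cartesian_product flip: UNIV_Times_UNIV)

lemma card_reduced_words_1: "card (reduced_words 1 :: ('x :: finite \<times> bool) list set) = 2 * card (UNIV :: 'x set)"
proof -
  have "reduced_words 1 = (\<lambda>a :: 'x \<times> bool. [a]) ` UNIV"
    by (auto simp: reduced_words_def length_Suc_conv reduced_Cons_iff)
  then show ?thesis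
    by (simp add: card_image inj_on_def card_letters)
qed

text \<open>A reduced word of positive length can be preceded by every letter except the inverse of
  its first one. The empty word has no first letter, so the recursion starts at length 1.\<close>

lemma card_reduced_words_Suc:
  assumes "n > 0"
  shows "card (reduced_words (Suc n) :: ('x :: finite \<times> bool) list set)
    = (2 * card (UNIV :: 'x set) - 1) * card (reduced_words n :: ('x \<times> bool) list set)"
proof -
  let ?S = "SIGMA w : (reduced_words n :: ('x \<times> bool) list set). UNIV - {inv_letter (hd w)}"
  have "bij_betw (\<lambda>(w, a). a # w) ?S (reduced_words (Suc n))"
  proof (rule bij_betw_byWitness[where f' = "\<lambda>w. (tl w, hd w)"])
    show "(\<lambda>(w, a). a # w) ` ?S \<subseteq> reduced_words (Suc n)"
      using assms by (auto simp: reduced_words_def reduced_Cons_iff)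
    show "(\<lambda>w. (tl w, hd w)) ` reduced_words (Suc n) \<subseteq> ?S"
      using assms
      by (auto simp: reduced_words_def length_Suc_conv reduced_Cons_iff) (metis inv_letter_inv_letter)
  qed (auto simp: reduced_words_def length_Suc_conv)
  then have "card (reduced_words (Suc n) :: ('x \<times> bool) list set) = card ?S"
    by (simp add: bij_betw_same_card)
  also have "\<dots> = (\<Sum>w\<in>(reduced_words n :: ('x \<times> bool) list set). card (UNIV - {inv_letter (hd w)}))"
    by (rule card_SigmaI) (auto simp: finite_reduced_words)
  also have "\<dots> = (2 * card (UNIV :: 'x set) - 1) * card (reduced_words n :: ('x \<times> bool) list set)"
    by (simp add: card_Diff_singleton card_letters mult.commute)
  finally show ?thesis .
qed

text \<open>With \<open>r\<close> generators there are \<open>2 * r * q ^ (n - 1)\<close> reduced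
  words of length \<open>n > 0\<close>, and \<open>2 * r = q + 1\<close> lies between
  \<open>q\<close> and \<open>2 * q\<close>.\<close>

lemma card_reduced_words_bounds:
  fixes q
  defines "q \<equiv> 2 * card (UNIV :: 'x :: finite set) - 1"
  shows "q ^ n \<le> card (reduced_words n :: ('x \<times> bool) list set) \<and>
    card (reduced_words n :: ('x \<times> bool) list set) \<le> 2 * q ^ n"
proof (induction n)
  case 0
  have "reduced_words 0 = {[] :: ('x \<times> bool) list}"
    by (auto simp: reduced_words_def)
  then show ?case by simp
next
  case (Suc n)
  have "card (UNIV :: 'x set) > 0"
    by (simp add: card_gt_0_iff)
  then show ?case
    using Suc card_reduced_words_1[where 'x = 'x] card_reduced_words_Suc[of n, where 'x = 'x]
    by (cases "n = 0") (auto simp: q_def)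
qed

lemma word_count_free_group:
  "word_count TYPE('x :: finite free_group) n = (\<Sum>i\<le>n. card (reduced_words i :: ('x \<times> bool) list set))"
proof -
  have "word_count TYPE('x free_group) n = card (\<Union>i\<le>n. reduced_words i :: ('x \<times> bool) list set)"
    unfolding word_count_def bij_betw_same_card[OF bij_betw_free_group]
    by (rule arg_cong[of _ _ card]) (auto simp: reduced_words_def)
  also have "\<dots> = (\<Sum>i\<le>n. card (reduced_words i :: ('x \<times> bool) list set))"
    by (rule card_UN_disjoint) (auto simp: finite_reduced_words, auto simp: reduced_words_def)
  finally show ?thesis .
qed

section \<open>The free algebra and the free group algebra\<close>

theorem corollary4:
  assumes "card (UNIV :: 'x :: finite set) > 1"
  shows "(\<forall>M :: ('m, ('x, 'k :: field) free_algebra) right_module. right_module M \<longrightarrow>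
      (\<exists>N. largest_nonmaximal_submodule M N \<and>
        (\<forall>L. right_submodule (quotient_module M N) L \<and> L \<noteq> {\<zero>\<^bsub>quotient_module M N\<^esub>} \<longrightarrow>
          maximal_growth ((quotient_module M N)\<lparr>carrier := L\<rparr>)))) \<and>
    (\<forall>M :: ('m, ('x, 'k) free_group_algebra) right_module. right_module M \<longrightarrow>
      (\<exists>N. largest_nonmaximal_submodule M N \<and>
        (\<forall>L. right_submodule (quotient_module M N) L \<and> L \<noteq> {\<zero>\<^bsub>quotient_module M N\<^esub>} \<longrightarrow>
          maximal_growth ((quotient_module M N)\<lparr>carrier := L\<rparr>))))"
proof (intro conjI allI impI)
  let ?r = "card (UNIV :: 'x set)"
  fix M :: "('m, ('x, 'k) free_algebra) right_module"
  assume "right_module M"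
  \<comment> \<open>There are \<open>?r ^ i\<close> words of length \<open>i\<close>; the constant 4
    comes from \<open>word_count_bounds\<close>.\<close>
  then have "exponential_growth_module M ?r 4"
    using assms word_count_bounds[of ?r "\<lambda>i. ?r ^ i"]
    by (intro exponential_growth_module.intro word_algebra_module.intro monoid_algebra_module.intro
        exponential_growth_module_axioms.intro) (auto simp: word_count_free_monoid)
  then show "\<exists>N. largest_nonmaximal_submodule M N \<and>
      (\<forall>L. right_submodule (quotient_module M N) L \<and> L \<noteq> {\<zero>\<^bsub>quotient_module M N\<^esub>} \<longrightarrow>
        maximal_growth ((quotient_module M N)\<lparr>carrier := L\<rparr>))"
    by (rule exponential_growth_module.nonmaximal_radical)
next
  let ?q = "2 * card (UNIV :: 'x set) - 1"
  fix M :: "('m, ('x, 'k) free_group_algebra) right_module"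
  assume "right_module M"
  \<comment> \<open>The base is the number of choices for each further letter of a nonempty reduced
    word.\<close>
  then have "exponential_growth_module M ?q 4"
    using assms card_reduced_words_bounds[where 'x = 'x]
      word_count_bounds[of ?q "\<lambda>i. card (reduced_words i :: ('x \<times> bool) list set)"]
    by (intro exponential_growth_module.intro word_algebra_module.intro monoid_algebra_module.intro
        exponential_growth_module_axioms.intro) (auto simp: word_count_free_group)
  then show "\<exists>N. largest_nonmaximal_submodule M N \<and>
      (\<forall>L. right_submodule (quotient_module M N) L \<and> L \<noteq> {\<zero>\<^bsub>quotient_module M N\<^esub>} \<longrightarrow>
        maximal_growth ((quotient_module M N)\<lparr>carrier := L\<rparr>))"
    by (rule exponential_growth_module.nonmaximal_radical)
qed

end
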